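(* If $d$ is a weakly threshold sequence and $e$ is a degree sequence such that $e \succeq d$ (that is, $e$ majorizes $d$), then $e$ is also a weakly threshold sequence.
   Context: Graphs are finite and simple, with at least one vertex. A degree sequence is the list $d=(d_1,\dots,d_n)$ of vertex degrees of a graph, written in nonincreasing order. For a degree sequence $d$ put $m(d)=\max\{i : d_i\ge i-1\}$ and, for $1\le k\le m(d)$, $\Delta_k(d)=k(k-1)+\sum_{i>k}\min\{k,d_i\}-\sum_{i=1}^k d_i$. A degree sequence $d$ is a weakly threshold sequence if $\Delta_k(d)\le 1$ for all $k\in\{1,\dots,m(d)\}$. For lists $p=(p_1,\dots,p_j)$ and $q=(q_1,\dots,q_k)$ of nonnegative integers (in nonincreasing order), $p\succeq q$ means that $\sum_{i=1}^j p_i=\sum_{i=1}^k q_i$ and, for each positive integer $l$, $\sum_{i=1}^l p_i\ge\sum_{i=1}^l q_i$, where undefined terms are taken to be $0$. *)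

theory Defs
  imports "Graph_Theory.Pair_Digraph" "HOL-Library.Multiset"
begin

text \<open>
  A finite simple graph is a \<^locale>\<open>pair_graph\<close>: a finite, loop-free, symmetric digraph without
  parallel arcs. Each edge is represented by its two orientations, so the degree of a vertex
  (its number of neighbours) is its out-degree.
\<close>

definition degree_list :: "'a pair_pre_digraph \<Rightarrow> nat list" where
  "degree_list G =
     rev (sorted_list_of_multiset (image_mset (out_degree (with_proj G)) (mset_set (pverts G))))"

text \<open>
  Taking the vertices to be natural numbers loses no generality, since every finite graph is
  isomorphic to such a graph; see \<open>is_degree_sequence_degree_list\<close> below.
\<close>

definition is_degree_sequence :: "nat list \<Rightarrow> bool" where
  "is_degree_sequence d \<longleftrightarrow>
     (\<exists>G :: nat pair_pre_digraph. pair_graph G \<and> pverts G \<noteq> {} \<and> d = degree_list G)"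

text \<open>The term $d_i$, counted from $1$; undefined terms are $0$.\<close>

definition seq_term :: "nat list \<Rightarrow> nat \<Rightarrow> nat" where
  "seq_term d i = (if 1 \<le> i \<and> i \<le> length d then d ! (i - 1) else 0)"

text \<open>
  The set below is finite, and it contains $1$ whenever the list is nonempty, as every degree
  sequence is. As $i \ge 1$, the truncated subtraction is exact.
\<close>

definition durfee_number :: "nat list \<Rightarrow> nat" where
  "durfee_number d = Max {i \<in> {1..length d}. seq_term d i \<ge> i - 1}"

definition EG_diff :: "nat list \<Rightarrow> nat \<Rightarrow> int" where
  "EG_diff d k =
     int k * (int k - 1) + (\<Sum>i\<in>{k<..length d}. int (min k (seq_term d i)))
       - (\<Sum>i=1..k. int (seq_term d i))"

definition weakly_threshold_sequence :: "nat list \<Rightarrow> bool" where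
  "weakly_threshold_sequence d \<longleftrightarrow>
     is_degree_sequence d \<and> (\<forall>k\<in>{1..durfee_number d}. EG_diff d k \<le> 1)"

definition majorizes :: "nat list \<Rightarrow> nat list \<Rightarrow> bool"  (infix "\<succeq>" 50) where
  "p \<succeq> q \<longleftrightarrow>
     (\<Sum>i=1..length p. seq_term p i) = (\<Sum>i=1..length q. seq_term q i) \<and>
     (\<forall>l\<ge>1. (\<Sum>i=1..l. seq_term p i) \<ge> (\<Sum>i=1..l. seq_term q i))"

lemma is_degree_sequence_degree_list:
  fixes G :: "'a pair_pre_digraph"
  assumes G: "pair_graph G" and ne: "pverts G \<noteq> {}"
  shows "is_degree_sequence (degree_list G)"
proof -
  interpret pair_graph G by (rule G)
  have fin: "finite (pverts G)" by (rule pair_finite_verts)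
  then obtain f :: "'a \<Rightarrow> nat" where f: "inj_on f (pverts G)"
    using finite_imp_inj_to_nat_seg by blast
  define H where "H = \<lparr>pverts = f ` pverts G, parcs = map_prod f f ` parcs G\<rparr>"
  have H_sel: "pverts H = f ` pverts G" "parcs H = map_prod f f ` parcs G"
    by (simp_all add: H_def)
  have "pair_graph H"
  proof unfold_locales
    show "fst e \<in> pverts H" "snd e \<in> pverts H" if "e \<in> parcs H" for e
      using that by (auto simp: H_sel dest: wellformed')
    show "finite (pverts H)" "finite (parcs H)"
      using pair_finite_verts pair_finite_arcs by (auto simp: H_sel)
    show "fst e \<noteq> snd e" if "e \<in> parcs H" for e
    proof -
      from that obtain u v where uv: "(u, v) \<in> parcs G" "e = (f u, f v)"
        by (auto simp: H_sel)
      then have "u \<in> pverts G" "v \<in> pverts G" "u \<noteq> v"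
        using wellformed' pair_no_loops by fastforce+
      with f uv show ?thesis by (auto dest: inj_onD)
    qed
    have "sym (parcs G)" using pair_sym_arcs by (simp add: symmetric_def)
    then show "symmetric (with_proj H)"
      by (force simp: symmetric_def H_sel sym_def)
  qed
  moreover have "out_degree (with_proj H) (f v) = out_degree (with_proj G) v" if v: "v \<in> pverts G" for v
  proof -
    have "out_arcs (with_proj H) (f v) = map_prod f f ` out_arcs (with_proj G) v"
    proof (intro equalityI subsetI)
      fix e assume "e \<in> out_arcs (with_proj H) (f v)"
      then obtain u w where uw: "(u, w) \<in> parcs G" "e = (f u, f w)" "f u = f v"
        by (auto simp: H_sel)
      moreover have "u \<in> pverts G" using uw(1) by (rule in_arcsD1)
      ultimately have "u = v" using f v by (auto dest: inj_onD)
      with uw show "e \<in> map_prod f f ` out_arcs (with_proj G) v" by force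
    qed (auto simp: H_sel)
    moreover have "inj_on (map_prod f f) (out_arcs (with_proj G) v)"
    proof (rule inj_on_subset)
      show "inj_on (map_prod f f) (pverts G \<times> pverts G)"
        using f by (rule map_prod_inj_on) (rule f)
      show "out_arcs (with_proj G) v \<subseteq> pverts G \<times> pverts G"
        by (auto dest: wellformed')
    qed
    ultimately show ?thesis by (simp add: out_degree_def card_image)
  qed
  then have "image_mset (out_degree (with_proj H) \<circ> f) (mset_set (pverts G)) =
      image_mset (out_degree (with_proj G)) (mset_set (pverts G))"
    using fin by (intro image_mset_cong) auto
  then have "degree_list H = degree_list G"
    using f by (simp add: degree_list_def H_sel image_mset_mset_set[symmetric] multiset.map_comp)
  moreover have "pverts H \<noteq> {}" using ne by (simp add: H_sel)
  ultimately show ?thesis unfolding is_degree_sequence_def by metis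
qed

end

theory Submission
  imports Defs
begin

text \<open>
  Write $x^+ = \max\{x, 0\}$ and $T_k(d) = \sum_i \min\{k,d_i\} - \sum_{i\le k} d_i - k$. Both
  sums in $T_k$ react to majorization in the same direction: if $e \succeq d$, the initial sums of
  $e$ are larger, and $\sum_i \min\{k, e_i\} \le \sum_i \min\{k, d_i\}$, because this truncated sum
  is an initial sum of the conjugate partition. Hence $T_k(e) \le T_k(d)$ for every $k$
  (\<open>majorizes_truncated_EG_diff_mono\<close>). On the other hand
  $\Delta_k(d) = T_k(d) + \sum_{i\le k} (k-d_i)^+$ (\<open>EG_diff_eq_truncated_EG_diff\<close>), so that
  $\Delta_k = T_k$ as soon as $d_k \ge k$, and $T_k \le \Delta_k$ always.

  Two things remain, because $e$ and $d$ may have different values of $m$ and because the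
  correction term need not vanish at $k = m(e)$.

  First, $T_k(d) \le 1$ holds for all $k$, not only for $k \le m(d)$
  (\<open>truncated_EG_diff_le_1\<close>): for $k > m(d)$ it follows from the inequality $\Delta_t(d) \le 1$ at
  the much smaller index $t = d_{k+1}$, the point where the Ferrers diagram of $d$ leaves row
  $k+1$. Second, if $e_k \ge k$ fails for some $k \le m(e)$, then $e_k = k-1$, and in this case
  $\Delta_k(e) = \Delta_{k-1}(e)$ (\<open>EG_diff_Suc_eq\<close>), which moves the question to an
  index where $\Delta = T$.
\<close>

section \<open>Nonincreasing sequences padded with zeros\<close>

lemma degree_sequence_sorted:
  assumes "is_degree_sequence d"
  shows "sorted (rev d)"
  using assms by (auto simp: is_degree_sequence_def degree_list_def)

lemma degree_sequence_nonempty: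
  assumes "is_degree_sequence d"
  shows "d \<noteq> []"
proof -
  obtain G :: "nat pair_pre_digraph"
    where G: "pair_graph G" "pverts G \<noteq> {}" "d = degree_list G"
    using assms by (auto simp: is_degree_sequence_def)
  interpret pair_graph G by (rule G(1))
  have "length d = card (pverts G)"
    by (simp add: G(3) degree_list_def flip: size_mset)
  with G(2) pair_finite_verts show ?thesis by auto
qed

lemma seq_term_antimono:
  assumes "sorted (rev d)" "1 \<le> i" "i \<le> j"
  shows "seq_term d j \<le> seq_term d i"
  using assms by (auto simp: seq_term_def sorted_rev_iff_nth_mono)

lemma sum_seq_term_pad:
  fixes h :: "nat \<Rightarrow> 'a::comm_monoid_add"
  assumes "h 0 = 0" "length d \<le> N"
  shows "(\<Sum>i\<in>{k<..length d}. h (seq_term d i)) = (\<Sum>i\<in>{k<..N}. h (seq_term d i))"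
  using assms by (intro sum.mono_neutral_left) (auto simp: seq_term_def)

lemma sum_split_interval:
  fixes g :: "nat \<Rightarrow> 'a::comm_monoid_add"
  assumes "k \<le> N"
  shows "sum g {0<..N} = sum g {0<..k} + sum g {k<..N}"
  using assms by (subst sum.union_disjoint[symmetric]) (auto intro!: sum.cong)

lemma interval_1_eq: "{1..n::nat} = {0<..n}"
  by auto

lemma durfee_number_props:
  assumes "d \<noteq> []"
  shows "durfee_number d \<in> {1..length d}"
    and "durfee_number d - 1 \<le> seq_term d (durfee_number d)"
    and "\<And>i. 1 \<le> i \<Longrightarrow> i - 1 \<le> seq_term d i \<Longrightarrow> i \<le> durfee_number d"
proof -
  let ?S = "{i \<in> {1..length d}. seq_term d i \<ge> i - 1}"
  have "1 \<in> ?S" using assms by (cases d) auto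
  then have "durfee_number d \<in> ?S"
    unfolding durfee_number_def by (intro Max_in) auto
  then show "durfee_number d \<in> {1..length d}"
    and "durfee_number d - 1 \<le> seq_term d (durfee_number d)" by auto
  show "i \<le> durfee_number d" if "1 \<le> i" "i - 1 \<le> seq_term d i" for i
  proof (cases "i \<le> length d")
    case True
    with that show ?thesis unfolding durfee_number_def by (intro Max_ge) auto
  next
    \<comment> \<open>Beyond the list the term is $0$, which leaves only $i = 1$.\<close>
    case False
    with that \<open>durfee_number d \<in> ?S\<close> show ?thesis by (auto simp: seq_term_def)
  qed
qed

section \<open>A form of the Erdos--Gallai differences that is monotone under majorization\<close>

definition truncated_EG_diff :: "nat list \<Rightarrow> nat \<Rightarrow> int" where
  "truncated_EG_diff d k =
     (\<Sum>i=1..length d. int (min k (seq_term d i))) - (\<Sum>i=1..k. int (seq_term d i)) - int k"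

text \<open>
  Move the first $k$ terms $\min\{k, d_i\}$ into the truncated sum and use
  $k = \min\{k, d_i\} + (k - d_i)^+$; the truncated subtraction of natural numbers is exactly
  this positive part.
\<close>

lemma EG_diff_eq_truncated_EG_diff:
  "EG_diff d k = truncated_EG_diff d k + (\<Sum>i=1..k. int (k - seq_term d i))"
proof -
  define N where "N = max k (length d)"
  have N: "k \<le> N" "length d \<le> N" by (auto simp: N_def)
  let ?m = "\<lambda>i. int (min k (seq_term d i))"
  have pad: "sum ?m {l<..length d} = sum ?m {l<..N}" for l
    by (rule sum_seq_term_pad[of "\<lambda>x. int (min k x)"]) (use N in auto)
  have "int k * int k = (\<Sum>i\<in>{0<..k}. int k)" by simp
  also have "\<dots> = (\<Sum>i\<in>{0<..k}. ?m i + int (k - seq_term d i))"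
    by (intro sum.cong) auto
  finally have "int k * int k = sum ?m {0<..k} + (\<Sum>i\<in>{0<..k}. int (k - seq_term d i))"
    by (simp add: sum.distrib)
  then show ?thesis
    using sum_split_interval[OF N(1), of ?m]
    unfolding EG_diff_def truncated_EG_diff_def interval_1_eq pad
    by (simp add: algebra_simps)
qed

corollary truncated_EG_diff_le_EG_diff: "truncated_EG_diff d k \<le> EG_diff d k"
  unfolding EG_diff_eq_truncated_EG_diff by (simp add: sum_nonneg)

corollary EG_diff_eq_truncated_if_le:
  assumes "sorted (rev d)" "k \<le> seq_term d k"
  shows "EG_diff d k = truncated_EG_diff d k"
proof -
  have "k - seq_term d i = 0" if "i \<in> {1..k}" for i
    using seq_term_antimono[OF assms(1), of i k] assms(2) that by auto
  then show ?thesis unfolding EG_diff_eq_truncated_EG_diff by simp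
qed

text \<open>
  Since the totals agree, it suffices to compare the excesses $\sum_i (d_i-k)^+$. As $d$ is
  nonincreasing, its excess is collected by an initial segment $\{1,\dots,s\}$, where the initial
  sum of $e$ is at least as large; and $\sum_{i\le s} (e_i-k)$ never exceeds the whole excess of
  $e$.
\<close>

lemma majorizes_sum_min_le:
  assumes "sorted (rev d)" "e \<succeq> d"
  shows "(\<Sum>i=1..length e. int (min k (seq_term e i))) \<le> (\<Sum>i=1..length d. int (min k (seq_term d i)))"
proof -
  define N where "N = max (length e) (length d)"
  have N: "length e \<le> N" "length d \<le> N" by (auto simp: N_def)
  let ?d = "seq_term d" and ?e = "seq_term e"
  define s where "s = card {i\<in>{0<..N}. k < ?d i}"
  have "s \<le> card {0<..N}" unfolding s_def by (intro card_mono) auto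
  then have sN: "s \<le> N" by simp
  have seg: "{i\<in>{0<..N}. k < ?d i} = {0<..s}"
  proof -
    let ?A = "{i\<in>{0<..N}. k < ?d i}"
    have down: "j \<in> ?A" if "i \<in> ?A" "0 < j" "j \<le> i" for i j
      using that seq_term_antimono[OF assms(1), of j i] by auto
    show ?thesis
    proof (cases "?A = {}")
      case True
      then have "s = 0" unfolding s_def by (metis card.empty)
      with True show ?thesis by auto
    next
      case False
      have "?A = {0<..Max ?A}"
      proof (intro equalityI subsetI)
        fix x assume "x \<in> ?A"
        then show "x \<in> {0<..Max ?A}" by auto
      next
        fix x assume "x \<in> {0<..Max ?A}"
        moreover have "Max ?A \<in> ?A" using False by (intro Max_in) auto
        ultimately show "x \<in> ?A" using down by simp
      qed
      moreover from this have "s = Max ?A"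
        unfolding s_def by (metis card_greaterThanAtMost diff_zero)
      ultimately show ?thesis by simp
    qed
  qed
  then have seg_iff: "k < ?d i \<longleftrightarrow> i \<le> s" if "i \<in> {0<..N}" for i
    using that sN unfolding set_eq_iff by auto
  have total: "(\<Sum>i\<in>{0<..N}. int (?e i)) = (\<Sum>i\<in>{0<..N}. int (?d i))"
    and initial: "(\<Sum>i\<in>{0<..s}. int (?d i)) \<le> (\<Sum>i\<in>{0<..s}. int (?e i))"
  proof -
    have "(\<Sum>i\<in>{0<..N}. ?e i) = (\<Sum>i\<in>{0<..N}. ?d i)"
      using assms(2) sum_seq_term_pad[of "\<lambda>x. x" e N 0] sum_seq_term_pad[of "\<lambda>x. x" d N 0] N
      unfolding majorizes_def interval_1_eq by simp
    then show "(\<Sum>i\<in>{0<..N}. int (?e i)) = (\<Sum>i\<in>{0<..N}. int (?d i))"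
      by (metis of_nat_sum)
    have "(\<Sum>i\<in>{0<..s}. ?d i) \<le> (\<Sum>i\<in>{0<..s}. ?e i)"
      using assms(2) unfolding majorizes_def interval_1_eq by (cases s) auto
    then show "(\<Sum>i\<in>{0<..s}. int (?d i)) \<le> (\<Sum>i\<in>{0<..s}. int (?e i))"
      by (metis of_nat_le_iff of_nat_sum)
  qed
  have excess: "(\<Sum>i\<in>{0<..N}. int (min k (c i)))
      = (\<Sum>i\<in>{0<..N}. int (c i)) - (\<Sum>i\<in>{0<..N}. int (c i - k))" for c :: "nat \<Rightarrow> nat"
    unfolding sum_subtractf[symmetric] by (intro sum.cong) auto
  have "(\<Sum>i\<in>{0<..N}. int (?d i - k)) = (\<Sum>i\<in>{0<..s}. int (?d i - k))"
  proof (intro sum.mono_neutral_right ballI)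
    show "int (?d i - k) = 0" if "i \<in> {0<..N} - {0<..s}" for i
      using seg_iff[of i] that by auto
  qed (use sN in auto)
  also have "\<dots> = (\<Sum>i\<in>{0<..s}. int (?d i) - int k)"
  proof (intro sum.cong refl)
    show "int (?d i - k) = int (?d i) - int k" if "i \<in> {0<..s}" for i
      using seg_iff[of i] that sN by simp
  qed
  also have "\<dots> \<le> (\<Sum>i\<in>{0<..s}. int (?e i) - int k)"
    using initial by (simp add: sum_subtractf)
  also have "\<dots> \<le> (\<Sum>i\<in>{0<..s}. int (?e i - k))"
    by (intro sum_mono) auto
  also have "\<dots> \<le> (\<Sum>i\<in>{0<..N}. int (?e i - k))"
    by (intro sum_mono2) (use sN in auto)
  finally have "(\<Sum>i\<in>{0<..N}. int (min k (?e i))) \<le> (\<Sum>i\<in>{0<..N}. int (min k (?d i)))"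
    unfolding excess total by simp
  then show ?thesis
    using sum_seq_term_pad[of "\<lambda>x. int (min k x)" e N 0]
      sum_seq_term_pad[of "\<lambda>x. int (min k x)" d N 0] N
    unfolding interval_1_eq by simp
qed

lemma majorizes_truncated_EG_diff_mono:
  assumes "sorted (rev d)" "e \<succeq> d"
  shows "truncated_EG_diff e k \<le> truncated_EG_diff d k"
proof -
  have "(\<Sum>i=1..k. seq_term d i) \<le> (\<Sum>i=1..k. seq_term e i)"
    using assms(2) unfolding majorizes_def by (cases k) auto
  then have "(\<Sum>i=1..k. int (seq_term d i)) \<le> (\<Sum>i=1..k. int (seq_term e i))"
    by (metis of_nat_le_iff of_nat_sum)
  with majorizes_sum_min_le[OF assms, of k] show ?thesis
    unfolding truncated_EG_diff_def by linarith
qed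

section \<open>Controlling the differences beyond and at the Durfee number\<close>

text \<open>
  For $k > m(d)$ all terms after the $k$-th are below $k$, so
  $T_k(d) = \sum_{i>k} d_i - \sum_{i\le k} (d_i-k)^+ - k$. Put $t = d_{k+1}$. If $t = 0$ the first
  sum vanishes. Otherwise $t \le m(d)$, because $t < k$ and so $d_t \ge d_{k+1} = t$; in $\Delta_t(d)$ every term $\min\{t, d_i\}$ equals $t$
  for $t < i \le k$ and $d_i$ for $i > k$; thus $\Delta_t(d) \le 1$ reads
  $\sum_{i>k} d_i \le 1 + t + \sum_{i\le t} (d_i - k)$, which gives $T_k(d) \le 1 + t - k \le 0$.
\<close>

lemma truncated_EG_diff_le_1:
  assumes "sorted (rev d)" "d \<noteq> []" "1 \<le> k"
    and wt: "\<forall>k\<in>{1..durfee_number d}. EG_diff d k \<le> 1"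
  shows "truncated_EG_diff d k \<le> 1"
proof (cases "k \<le> durfee_number d")
  case True
  with wt \<open>1 \<le> k\<close> have "EG_diff d k \<le> 1" by simp
  with truncated_EG_diff_le_EG_diff[of d k] show ?thesis by linarith
next
  case False
  let ?d = "seq_term d"
  note anti = seq_term_antimono[OF assms(1)]
  note durfee_max = durfee_number_props(3)[OF assms(2)]
  define t where "t = ?d (Suc k)"
  define N where "N = max k (length d)"
  have N: "k \<le> N" "length d \<le> N" by (auto simp: N_def)
  have "?d k < k - 1" using False durfee_max[of k] \<open>1 \<le> k\<close> by linarith
  then have tk: "t + 1 < k" using anti[of k "Suc k"] \<open>1 \<le> k\<close> by (simp add: t_def)
  have tail_le: "?d i \<le> t" if "k < i" for i using anti[of "Suc k" i] that by (simp add: t_def)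
  have head_ge: "t \<le> ?d i" if "0 < i" "i \<le> k" for i
    using anti[of i "Suc k"] that by (simp add: t_def)
  define R where "R = (\<Sum>i\<in>{k<..N}. int (?d i))"
  define P where "P = (\<Sum>i\<in>{0<..k}. int (?d i - k))"
  have "(\<Sum>i\<in>{k<..N}. int (min k (?d i))) = R"
    unfolding R_def using tail_le tk by (intro sum.cong) force+
  moreover have "(\<Sum>i\<in>{0<..k}. int (min k (?d i))) - (\<Sum>i\<in>{0<..k}. int (?d i)) = - P"
    unfolding P_def sum_subtractf[symmetric] sum_negf[symmetric] by (intro sum.cong) auto
  ultimately have T: "truncated_EG_diff d k = R - P - int k"
    using sum_split_interval[OF N(1), of "\<lambda>i. int (min k (?d i))"]
      sum_seq_term_pad[of "\<lambda>x. int (min k x)" d N 0] N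
    unfolding truncated_EG_diff_def interval_1_eq by simp
  have "R \<le> 1 + int t + P"
  proof (cases "t = 0")
    case True
    then have "R = 0" unfolding R_def using tail_le by (intro sum.neutral) force
    moreover have "0 \<le> P" unfolding P_def by (simp add: sum_nonneg)
    ultimately show ?thesis by linarith
  next
    case False
    then have "t \<le> durfee_number d" using durfee_max[of t] head_ge[of t] tk by simp
    then have "EG_diff d t \<le> 1" using wt False by simp
    moreover have "(\<Sum>i\<in>{t<..length d}. int (min t (?d i))) = int t * (int k - int t) + R"
    proof -
      let ?m = "\<lambda>i. int (min t (?d i))"
      have "(\<Sum>i\<in>{t<..length d}. ?m i) = sum ?m {t<..N}"
        by (rule sum_seq_term_pad[of "\<lambda>x. int (min t x)"]) (use N in auto)
      also have "\<dots> = sum ?m {t<..k} + sum ?m {k<..N}"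
        using sum_split_interval[of k N ?m] sum_split_interval[of t N ?m]
          sum_split_interval[of t k ?m] N tk by simp
      also have "sum ?m {t<..k} = (\<Sum>i\<in>{t<..k}. int t)"
        using head_ge by (intro sum.cong) (auto simp: min_def)
      also have "sum ?m {k<..N} = R"
        unfolding R_def using tail_le by (intro sum.cong) (simp_all add: min_absorb2)
      finally show ?thesis using tk by (simp add: algebra_simps of_nat_diff)
    qed
    moreover have "(\<Sum>i\<in>{0<..t}. int (?d i)) \<le> int t * int k + P"
    proof -
      have "(\<Sum>i\<in>{0<..t}. int (?d i)) \<le> (\<Sum>i\<in>{0<..t}. int k + int (?d i - k))"
        by (intro sum_mono) auto
      also have "\<dots> = int t * int k + (\<Sum>i\<in>{0<..t}. int (?d i - k))"
        by (simp add: sum.distrib)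
      also have "(\<Sum>i\<in>{0<..t}. int (?d i - k)) \<le> P"
        unfolding P_def using tk by (intro sum_mono2) auto
      finally show ?thesis by simp
    qed
    ultimately show ?thesis
      unfolding EG_diff_def interval_1_eq by (simp add: algebra_simps)
  qed
  with T tk show ?thesis by linarith
qed

text \<open>
  Passing from $k$ to $k+1$ adds $2k$ to the quadratic term, while $d_{k+1} = k$ is removed from
  the sum of minima and subtracted once more. The later terms are at most $k$, so raising the
  truncation level leaves their contribution unchanged.
\<close>

lemma EG_diff_Suc_eq:
  assumes "sorted (rev d)" "Suc k \<le> length d" "seq_term d (Suc k) = k"
  shows "EG_diff d (Suc k) = EG_diff d k"
proof -
  let ?d = "seq_term d"
  have "?d i \<le> k" if "Suc k < i" for i
    using seq_term_antimono[OF assms(1), of "Suc k" i] assms(3) that by simp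
  then have later: "(\<Sum>i\<in>{Suc k<..length d}. int (min (Suc k) (?d i)))
      = (\<Sum>i\<in>{Suc k<..length d}. int (min k (?d i)))"
    by (intro sum.cong) force+
  have "{k<..length d} = insert (Suc k) {Suc k<..length d}" using assms(2) by auto
  then have "(\<Sum>i\<in>{k<..length d}. int (min k (?d i)))
      = int k + (\<Sum>i\<in>{Suc k<..length d}. int (min k (?d i)))"
    by (simp add: assms(3))
  then show ?thesis
    unfolding EG_diff_def later by (simp add: assms(3) algebra_simps)
qed

section \<open>Weakly threshold sequences are upward closed under majorization\<close>

theorem theorem2p7:
  fixes d e :: "nat list"
  assumes "weakly_threshold_sequence d"
    and "is_degree_sequence e"
    and "e \<succeq> d"
  shows "weakly_threshold_sequence e"
proof -
  have d: "is_degree_sequence d" "\<forall>k\<in>{1..durfee_number d}. EG_diff d k \<le> 1"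
    using assms(1) by (auto simp: weakly_threshold_sequence_def)
  note sd = degree_sequence_sorted[OF d(1)] and nd = degree_sequence_nonempty[OF d(1)]
  note se = degree_sequence_sorted[OF assms(2)] and ne = degree_sequence_nonempty[OF assms(2)]
  have full: "EG_diff e k \<le> 1" if "1 \<le> k" "k \<le> seq_term e k" for k
    using EG_diff_eq_truncated_if_le[OF se that(2)]
      majorizes_truncated_EG_diff_mono[OF sd assms(3), of k]
      truncated_EG_diff_le_1[OF sd nd that(1) d(2)] by linarith
  have "EG_diff e k \<le> 1" if k: "k \<in> {1..durfee_number e}" for k
  proof (cases "k \<le> seq_term e k")
    case True
    with k show ?thesis by (intro full) auto
  next
    case False
    note props = durfee_number_props[OF ne]
    obtain l where l: "k = Suc l" using k by (cases k) auto
    have "seq_term e (durfee_number e) \<le> seq_term e k" using k by (intro seq_term_antimono se) auto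
    with False props(2) k l have el: "seq_term e (Suc l) = l" by auto
    have "EG_diff e k = EG_diff e l"
      using EG_diff_Suc_eq[OF se _ el] props(1) k l by auto
    also have "\<dots> \<le> 1"
    proof (cases "l = 0")
      case True
      then show ?thesis by (simp add: EG_diff_def)
    next
      case False
      with el seq_term_antimono[OF se, of l "Suc l"] show ?thesis by (intro full) auto
    qed
    finally show ?thesis .
  qed
  with assms(2) show ?thesis by (simp add: weakly_threshold_sequence_def)
qed

end
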